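(* Let $\mathfrak{L}$ be the complex Lie algebra with basis $\{e_i\}_{i\in\mathbb{N}}$ and brackets $[e_1,e_n]=e_n$ for $n\ge2$ (all other brackets of basis elements, up to skew-symmetry, being zero). Let $\varphi$ be a $\frac12$-derivation of $\mathfrak{L}$. Then there are complex numbers $\alpha$ and $\{\alpha_i\}_{i\ge2}$ (only finitely many nonzero) such that $$\varphi(e_1)=\alpha e_1+\sum_{i\ge2}\alpha_ie_i,\qquad \varphi(e_n)=\alpha e_n\quad(n\ge2).$$
   Context: $\mathbb{N}=\{1,2,3,\ldots\}$. A $\frac12$-derivation of a Lie algebra $\mathfrak{L}$ is a linear map $\varphi:\mathfrak{L}\to\mathfrak{L}$ with $\varphi([x,y])=\frac12\left([\varphi(x),y]+[x,\varphi(y)]\right)$ for all $x,y\in\mathfrak{L}$. *)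

theory Defs
  imports Complex_Main
begin

locale lie_algebra = vector_space scale
  for scale :: "'k::field \<Rightarrow> 'v::ab_group_add \<Rightarrow> 'v" +
  fixes bracket :: "'v \<Rightarrow> 'v \<Rightarrow> 'v"
  assumes bracket_linear_left: "Vector_Spaces.linear scale scale (\<lambda>x. bracket x y)"
    and bracket_linear_right: "Vector_Spaces.linear scale scale (\<lambda>y. bracket x y)"
    and bracket_self: "bracket x x = 0"
    and jacobi: "bracket x (bracket y z) + bracket y (bracket z x) + bracket z (bracket x y) = 0"

definition half_derivation ::
    "('k::field \<Rightarrow> 'v::ab_group_add \<Rightarrow> 'v) \<Rightarrow> ('v \<Rightarrow> 'v \<Rightarrow> 'v) \<Rightarrow> ('v \<Rightarrow> 'v) \<Rightarrow> bool" where
  "half_derivation scale bracket \<phi> \<longleftrightarrow>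
     Vector_Spaces.linear scale scale \<phi> \<and>
     (\<forall>x y. \<phi> (bracket x y) = scale (1/2) (bracket (\<phi> x) y + bracket x (\<phi> y)))"

definition indexed_basis ::
    "('k::field \<Rightarrow> 'v::ab_group_add \<Rightarrow> 'v) \<Rightarrow> 'i set \<Rightarrow> ('i \<Rightarrow> 'v) \<Rightarrow> bool" where
  "indexed_basis scale I e \<longleftrightarrow>
     inj_on e I \<and> \<not> module.dependent scale (e ` I) \<and> module.span scale (e ` I) = UNIV"

text \<open>The algebra is described up to isomorphism: an arbitrary complex Lie algebra together
  with a basis having the prescribed structure constants. Indices start at 1; \<open>e 0\<close> is
  unconstrained and plays no role.\<close>

locale almost_abelian_lie_algebra = lie_algebra scale bracket
  for scale :: "complex \<Rightarrow> 'v::ab_group_add \<Rightarrow> 'v"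
    and bracket :: "'v \<Rightarrow> 'v \<Rightarrow> 'v" +
  fixes e :: "nat \<Rightarrow> 'v"
  assumes basis: "indexed_basis scale {1..} e"
    and bracket_e1: "n \<ge> 2 \<Longrightarrow> bracket (e 1) (e n) = e n"
    and bracket_ee: "m \<ge> 2 \<Longrightarrow> n \<ge> 2 \<Longrightarrow> bracket (e m) (e n) = 0"

end

theory Submission
  imports Defs
begin

text \<open>Let \<open>W\<close> be the span of the \<open>e n\<close> with \<open>n \<ge> 2\<close>. The algebra is \<open>\<complex> e\<^sub>1 \<oplus> W\<close>, where \<open>W\<close> is an
  abelian ideal on which \<open>ad e\<^sub>1\<close> is the identity. Write \<open>\<phi> e\<^sub>1 = \<alpha> e\<^sub>1 + w\<^sub>0\<close> and, for \<open>n \<ge> 2\<close>,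
  \<open>\<phi> e\<^sub>n = c e\<^sub>1 + w\<close> with \<open>w\<^sub>0, w \<in> W\<close>. Twice the \<open>1/2\<close>-derivation identity for
  \<open>[e\<^sub>1, e\<^sub>n] = e\<^sub>n\<close> reads
  \<open>2 (c e\<^sub>1 + w) = [\<alpha> e\<^sub>1 + w\<^sub>0, e\<^sub>n] + [e\<^sub>1, c e\<^sub>1 + w] = \<alpha> e\<^sub>n + w\<close>.
  Hence \<open>2 c e\<^sub>1 = \<alpha> e\<^sub>n - w\<close> lies in \<open>W\<close>, so \<open>c = 0\<close> and \<open>w = \<alpha> e\<^sub>n\<close>. The factor \<open>1/2\<close> is
  what matters here: for an ordinary derivation the \<open>w\<close> terms would cancel and \<open>w\<close> would stay
  arbitrary. Expanding \<open>w\<^sub>0\<close> in the basis of \<open>W\<close> gives the coefficients of \<open>\<phi> e\<^sub>1\<close>.\<close>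

lemma (in vector_space) span_indexed_finite_support:
  assumes inj: "inj_on e I"
    and indep: "independent (e ` I)"
    and x: "x \<in> span (e ` I)"
  obtains a where "finite {i \<in> I. a i \<noteq> 0}" "x = (\<Sum>i | i \<in> I \<and> a i \<noteq> 0. scale (a i) (e i))"
proof
  let ?r = "representation (e ` I) x"
  let ?S = "{i \<in> I. ?r (e i) \<noteq> 0}"
  have img: "e ` ?S = {b. ?r b \<noteq> 0}"
    using representation_ne_zero by fastforce
  have injS: "inj_on e ?S"
    using inj by (rule inj_on_subset) auto
  show "finite ?S"
    using finite_representation[of "e ` I" x] injS unfolding img[symmetric]
    by (rule finite_imageD)
  have "x = (\<Sum>b | ?r b \<noteq> 0. scale (?r b) b)"
    using sum_nonzero_representation_eq[OF indep x] by simp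
  also have "\<dots> = (\<Sum>i\<in>?S. scale (?r (e i)) (e i))"
    unfolding img[symmetric] by (simp add: sum.reindex[OF injS])
  finally show "x = (\<Sum>i | i \<in> I \<and> ?r (e i) \<noteq> 0. scale (?r (e i)) (e i))" .
qed

context almost_abelian_lie_algebra
begin

definition W :: "'v set" where
  "W = span (e ` {2..})"

lemma e_in_W: "n \<ge> 2 \<Longrightarrow> e n \<in> W"
  unfolding W_def by (auto intro: span_base)

lemma range_split: "e ` {1..} = insert (e 1) (e ` {2..})"
proof -
  have "{1::nat..} = insert 1 {2..}" by auto
  then show ?thesis by (metis image_insert)
qed

lemma inj_on_e: "inj_on e {2..}"
  using basis unfolding indexed_basis_def by (auto intro: inj_on_subset)

lemma independent_e: "independent (e ` {2..})"
  using basis range_split unfolding indexed_basis_def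
  by (metis independent_mono subset_insertI)

lemma e1_notin_W: "e 1 \<notin> W"
proof -
  \<comment> \<open>Injectivity of the indexing is essential: a repetition of \<open>e 1\<close> among the \<open>e n\<close>
      would leave the set of basis vectors independent.\<close>
  have "e 1 \<notin> e ` {2..}"
    using basis unfolding indexed_basis_def inj_on_def by fastforce
  moreover have "independent (insert (e 1) (e ` {2..}))"
    using basis range_split unfolding indexed_basis_def by metis
  ultimately show ?thesis
    unfolding W_def by (simp add: independent_insert)
qed

lemma decompose:
  obtains c w where "w \<in> W" "x = scale c (e 1) + w"
proof -
  have "x \<in> span (insert (e 1) (e ` {2..}))"
    using basis range_split unfolding indexed_basis_def by (metis UNIV_I)
  then obtain c where "x - scale c (e 1) \<in> W"
    unfolding W_def span_insert by auto
  then show thesis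
    using that[of "x - scale c (e 1)" c] by simp
qed

lemma bracket_e1_W:
  assumes "w \<in> W"
  shows "bracket (e 1) w = w"
proof -
  interpret pair: vector_space_pair scale scale ..
  show ?thesis
  proof (rule pair.linear_eq_on_span[where f = "bracket (e 1)" and g = "\<lambda>w. w"])
    show "Vector_Spaces.linear scale scale (bracket (e 1))"
      by (rule bracket_linear_right)
    show "Vector_Spaces.linear scale scale (\<lambda>w. w)"
      by (rule linear_ident)
    show "w \<in> span (e ` {2..})"
      using assms unfolding W_def .
  qed (auto intro: bracket_e1 simp del: One_nat_def)
qed

lemma bracket_W_e:
  assumes "w \<in> W" "n \<ge> 2"
  shows "bracket w (e n) = 0"
proof -
  interpret pair: vector_space_pair scale scale ..
  show ?thesis
  proof (rule pair.linear_eq_0_on_span[where f = "\<lambda>x. bracket x (e n)"])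
    show "Vector_Spaces.linear scale scale (\<lambda>x. bracket x (e n))"
      by (rule bracket_linear_left)
    show "w \<in> span (e ` {2..})"
      using assms(1) unfolding W_def .
  qed (use assms(2) in \<open>auto intro: bracket_ee\<close>)
qed

lemma bracket_left_decomposed:
  assumes "w \<in> W" "n \<ge> 2"
  shows "bracket (scale c (e 1) + w) (e n) = scale c (e n)"
proof -
  interpret L: Vector_Spaces.linear scale scale "\<lambda>x. bracket x (e n)"
    by (rule bracket_linear_left)
  show ?thesis
    using assms by (simp add: L.add L.scale bracket_e1[OF assms(2)] bracket_W_e del: One_nat_def)
qed

lemma bracket_right_decomposed:
  assumes "w \<in> W"
  shows "bracket (e 1) (scale c (e 1) + w) = w"
proof -
  interpret R: Vector_Spaces.linear scale scale "bracket (e 1)"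
    by (rule bracket_linear_right)
  show ?thesis
    using assms by (simp add: R.add R.scale bracket_self bracket_e1_W del: One_nat_def)
qed

text \<open>The component of \<open>\<phi> (e 1)\<close> along \<open>e 1\<close> already determines \<open>\<phi>\<close> on \<open>W\<close>, because bracketing
  with \<open>e n\<close> annihilates the component in \<open>W\<close>.\<close>

lemma half_derivation_on_W_basis:
  assumes hd: "half_derivation scale bracket \<phi>"
    and w0: "w0 \<in> W" "\<phi> (e 1) = scale \<alpha> (e 1) + w0"
    and n: "n \<ge> 2"
  shows "\<phi> (e n) = scale \<alpha> (e n)"
proof -
  obtain c w where w: "w \<in> W" "\<phi> (e n) = scale c (e 1) + w"
    by (rule decompose)
  have "\<phi> (e n) = scale (1/2) (bracket (\<phi> (e 1)) (e n) + bracket (e 1) (\<phi> (e n)))"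
    using hd[unfolded half_derivation_def, THEN conjunct2, rule_format, of "e 1" "e n"]
    unfolding bracket_e1[OF n] .
  also have "\<dots> = scale (1/2) (scale \<alpha> (e n) + w)"
    unfolding w0(2) w(2) bracket_left_decomposed[OF w0(1) n] bracket_right_decomposed[OF w(1)] ..
  finally have half: "\<phi> (e n) = scale (1/2) (scale \<alpha> (e n) + w)" .
  have "scale c (e 1) = scale (1/2) (scale \<alpha> (e n) + w) - w"
    using half w(2) by (simp add: eq_diff_eq)
  also have "\<dots> \<in> W"
    using w(1) e_in_W[OF n] unfolding W_def by (intro span_diff span_scale span_add)
  finally have "scale c (e 1) \<in> W" .
  then have "scale (inverse c) (scale c (e 1)) \<in> W"
    unfolding W_def by (rule span_scale)
  then have "c = 0"
    using e1_notin_W by (cases "c = 0") auto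
  then have "\<phi> (e n) = w"
    using w(2) by simp
  moreover have "scale 2 (\<phi> (e n)) = scale \<alpha> (e n) + w"
    unfolding half by simp
  moreover have "scale 2 (\<phi> (e n)) = \<phi> (e n) + \<phi> (e n)"
    using scale_left_distrib[of 1 1 "\<phi> (e n)"] by simp
  ultimately show ?thesis by simp
qed

end

theorem lemma38:
  fixes scale :: "complex \<Rightarrow> 'v::ab_group_add \<Rightarrow> 'v"
    and bracket :: "'v \<Rightarrow> 'v \<Rightarrow> 'v"
    and e :: "nat \<Rightarrow> 'v"
    and \<phi> :: "'v \<Rightarrow> 'v"
  assumes "almost_abelian_lie_algebra scale bracket e"
    and "half_derivation scale bracket \<phi>"
  shows "\<exists>(\<alpha>::complex) (a::nat \<Rightarrow> complex).
           finite {i. i \<ge> 2 \<and> a i \<noteq> 0} \<and>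
           \<phi> (e 1) = scale \<alpha> (e 1) + (\<Sum>i | i \<ge> 2 \<and> a i \<noteq> 0. scale (a i) (e i)) \<and>
           (\<forall>n\<ge>2. \<phi> (e n) = scale \<alpha> (e n))"
proof -
  interpret almost_abelian_lie_algebra scale bracket e by fact
  obtain \<alpha> w0 where w0: "w0 \<in> W" "\<phi> (e 1) = scale \<alpha> (e 1) + w0"
    by (rule decompose)
  obtain a where a: "finite {i \<in> {2..}. a i \<noteq> 0}"
      "w0 = (\<Sum>i | i \<in> {2..} \<and> a i \<noteq> 0. scale (a i) (e i))"
    by (rule span_indexed_finite_support[OF inj_on_e independent_e w0(1)[unfolded W_def]])
  have "\<forall>n\<ge>2. \<phi> (e n) = scale \<alpha> (e n)"
    using half_derivation_on_W_basis[OF assms(2) w0] by blast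
  with a w0(2) show ?thesis
    unfolding atLeast_iff by blast
qed

end
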